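(* Let $n>1$. There is no (linear) isometric embedding of $\ell^1(n)$ into $M_k$ for any $k\in\mathbb{N}$.
   Context: $\ell^1(n)$ is $\mathbb{C}^n$ with the norm $\|(a_1,\ldots,a_n)\|_1=\sum_i|a_i|$. $M_k$ is the space of $k\times k$ complex matrices with the operator norm (as operators on $\mathbb{C}^k$ with the Euclidean norm). *)

theory Defs
  imports "HOL-Analysis.Analysis"
begin

definition l1_norm :: "complex ^ 'n \<Rightarrow> real" where
  "l1_norm a = (\<Sum>i\<in>UNIV. norm (a $ i))"

text \<open>
  The norm that the type class gives to \<open>complex ^ 'k ^ 'k\<close> is the Frobenius norm; the norm
  of the matrix space here is the operator norm instead. The norm on vectors that underlies
  \<open>onorm\<close> below is the Euclidean one.
\<close>

definition op_norm :: "complex ^ 'k ^ 'k \<Rightarrow> real" where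
  "op_norm A = onorm (\<lambda>v. A *v v)"

definition mat_scale :: "complex \<Rightarrow> complex ^ 'k ^ 'k \<Rightarrow> complex ^ 'k ^ 'k" where
  "mat_scale c A = (\<chi> i j. c * A $ i $ j)"

text \<open>
  The unqualified \<open>linear\<close> is real linearity. The locale predicate \<open>Vector_Spaces.linear\<close> with the
  two complex scalar multiplications is complex linearity. It also asserts that both scalings form
  vector spaces, which always holds: \<open>vec.vector_space_axioms\<close> and the lemma below.
\<close>

lemma vector_space_mat_scale: "vector_space mat_scale"
  by unfold_locales (simp_all add: mat_scale_def vec_eq_iff algebra_simps)

definition l1_isometric_embedding :: "(complex ^ 'n \<Rightarrow> complex ^ 'k ^ 'k) \<Rightarrow> bool" where
  "l1_isometric_embedding \<phi> \<longleftrightarrow>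
     Vector_Spaces.linear (*s) mat_scale \<phi> \<and> (\<forall>a. op_norm (\<phi> a) = l1_norm a)"

end

theory Submission
  imports Defs
begin

text \<open>
  It suffices to embed two coordinates: let \<open>A\<close> and \<open>B\<close> be the images of two distinct basis
  vectors. Both are contractions, and \<open>A + \<theta>B\<close> has operator norm \<open>2\<close> for every \<open>\<theta>\<close> on the unit
  circle. In finite dimension that norm is attained at some unit vector \<open>v\<close>, and strict
  convexity of the Euclidean norm forces \<open>Av = \<theta>Bv\<close> with \<open>\<bar>Av\<bar> = \<bar>Bv\<bar> = \<bar>v\<bar> = 1\<close>
  (\<open>norm_attained_vector\<close>).

  A contraction that preserves the norm of \<open>v\<close> preserves all inner products with \<open>v\<close>
  (\<open>inner_preserved_where_norm_preserved\<close>), that is, \<open>A\<^sup>*Av = v\<close> and \<open>B\<^sup>*Bv = v\<close>. Hence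
  \<open>B\<^sup>*Av = \<theta>v\<close>: every point of the unit circle would be an eigenvalue of the single matrix
  \<open>B\<^sup>*A\<close>. The proof does not form the adjoint; it shows directly that the vectors found for
  different \<open>\<theta>\<close> are orthogonal (\<open>orthogonal_norm_attaining_vectors\<close>). Infinitely many pairwise
  orthogonal nonzero vectors do not fit into \<open>\<complex>\<^sup>k\<close>.

  All inner products below are the real ones, \<open>Re \<langle>x, y\<rangle>\<close>. The complex inner product is recovered
  by letting a complex scalar run in one argument.
\<close>

section \<open>Norms and contractions in real inner product spaces\<close>

lemma onorm_attained:
  fixes f :: "'a::euclidean_space \<Rightarrow> 'b::real_normed_vector"
  assumes "bounded_linear f"
  obtains v where "norm v = 1" "norm (f v) = onorm f"
proof -
  interpret f: bounded_linear f by fact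
  have "compact (sphere (0::'a) 1)" "sphere (0::'a) 1 \<noteq> {}"
    by auto
  moreover have "continuous_on (sphere 0 1) (\<lambda>x. norm (f x))"
    by (intro continuous_intros f.continuous_on)
  ultimately obtain v where v: "v \<in> sphere 0 1" "\<And>y. y \<in> sphere 0 1 \<Longrightarrow> norm (f y) \<le> norm (f v)"
    by (metis continuous_attains_sup)
  have "norm (f x) \<le> norm (f v) * norm x" for x
  proof (cases "x = 0")
    case False
    then have "norm (f (x /\<^sub>R norm x)) \<le> norm (f v)"
      by (intro v(2)) simp
    with False show ?thesis
      by (simp add: f.scaleR field_simps)
  qed (simp add: f.zero)
  then have "onorm f \<le> norm (f v)"
    by (rule onorm_le)
  moreover have "norm (f v) \<le> onorm f"
    using onorm[OF assms, of v] v(1) by simp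
  ultimately show ?thesis
    using v(1) that[of v] by simp
qed

text \<open>Strict convexity of the ball, from the parallelogram law.\<close>

lemma eq_if_norm_add_eq_2:
  fixes x y :: "'a::real_inner"
  assumes "norm x \<le> 1" "norm y \<le> 1" "norm (x + y) = 2"
  shows "x = y"
proof -
  have "(norm (x - y))\<^sup>2 = 2 * (norm x)\<^sup>2 + 2 * (norm y)\<^sup>2 - (norm (x + y))\<^sup>2"
    by (simp add: power2_norm_eq_inner inner_simps inner_commute)
  moreover have "(norm x)\<^sup>2 \<le> 1" "(norm y)\<^sup>2 \<le> 1"
    using assms by (simp_all add: power_le_one)
  ultimately have "(norm (x - y))\<^sup>2 \<le> 0"
    using assms by simp
  then show ?thesis
    by simp
qed

text \<open>
  The form \<open>\<bar>x\<bar>\<^sup>2 - \<bar>f x\<bar>\<^sup>2\<close> is positive semidefinite and vanishes at \<open>v\<close>. So \<open>v\<close> minimises it, and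
  its derivative at \<open>v\<close> in every direction \<open>w\<close> is zero.
\<close>

lemma inner_preserved_where_norm_preserved:
  fixes f :: "'a::real_inner \<Rightarrow> 'b::real_inner"
  assumes "linear f" and contr: "\<And>x. norm (f x) \<le> norm x" and v: "norm (f v) = norm v"
  shows "f v \<bullet> f w = v \<bullet> w"
proof -
  interpret linear f by fact
  define p where "p = f v \<bullet> f w - v \<bullet> w"
  define q where "q = w \<bullet> w - f w \<bullet> f w"
  have inner_le: "f x \<bullet> f x \<le> x \<bullet> x" for x
    using contr[of x] by (simp add: norm_le)
  have q: "q \<ge> 0"
    using inner_le[of w] by (simp add: q_def)
  have vv: "f v \<bullet> f v = v \<bullet> v"
    using v by (simp add: norm_eq)
  have quad: "2 * t * p \<le> t\<^sup>2 * q" for t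
    using inner_le[of "v + t *\<^sub>R w"] vv unfolding p_def q_def
    by (simp add: add scale inner_simps inner_commute power2_eq_square algebra_simps)
  \<comment> \<open>Any \<open>t\<close> with \<open>p = t * r\<close> and \<open>2 * r > q\<close> works; the \<open>+ 1\<close> keeps the denominator positive.\<close>
  define t where "t = p / (q + 1)"
  have p: "p = t * (q + 1)"
    using q by (simp add: t_def)
  have "t\<^sup>2 * (q + 2) \<le> 0"
    using quad[of t] unfolding p by (simp add: power2_eq_square algebra_simps)
  then have "p = 0"
    using q p by (simp add: mult_le_0_iff)
  then show ?thesis
    by (simp add: p_def)
qed

section \<open>Complex scalars\<close>

lemma mat_scale_mult_vec: "mat_scale c A *v x = c *s (A *v x)"
  by (simp add: mat_scale_def matrix_vector_mult_def vec_eq_iff sum_distrib_left mult.assoc)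

lemma norm_complex_scale: "norm (c *s x) = norm c * norm (x :: complex ^ 'k::finite)"
  by (simp add: norm_vec_def L2_set_def norm_mult power_mult_distrib real_sqrt_mult
      flip: sum_distrib_left)

lemma inner_complex_scale_left:
  "(c *s x) \<bullet> y = x \<bullet> (cnj c *s (y :: complex ^ 'k::finite))"
  by (simp add: inner_vec_def inner_complex_def algebra_simps)

lemma infinite_unit_circle: "infinite (sphere (0::complex) 1)"
proof -
  have "connected (sphere (0::complex) 1)"
    by (rule connected_sphere) simp
  then have "uncountable (sphere (0::complex) 1)"
    by (rule connected_uncountable[of _ 1 "-1"]) auto
  then show ?thesis
    using countable_finite by blast
qed

section \<open>Pairs of matrices spanning a copy of the two-dimensional sum norm\<close>

lemma norm_attained_vector:
  fixes A B :: "complex ^ 'k::finite ^ 'k"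
  assumes "\<And>x. norm (A *v x) \<le> norm x" "\<And>x. norm (B *v x) \<le> norm x"
    and norm_\<theta>: "norm \<theta> = 1" and op: "op_norm (A + mat_scale \<theta> B) = 2"
  obtains v where "norm v = 1" "A *v v = \<theta> *s (B *v v)"
    "norm (A *v v) = norm v" "norm (B *v v) = norm v"
proof -
  obtain v where v: "norm v = 1" "norm ((A + mat_scale \<theta> B) *v v) = 2"
    using onorm_attained[OF matrix_vector_mul_bounded_linear, of "A + mat_scale \<theta> B"] op
    unfolding op_norm_def by metis
  define x y where "x = A *v v" and "y = \<theta> *s (B *v v)"
  have "norm x \<le> 1"
    using assms(1)[of v] v(1) by (simp add: x_def)
  moreover have norm_y: "norm y = norm (B *v v)"
    using norm_\<theta> by (simp add: y_def norm_complex_scale)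
  moreover have "norm (B *v v) \<le> 1"
    using assms(2)[of v] v(1) by simp
  moreover have sum: "norm (x + y) = 2"
    using v(2) by (simp add: x_def y_def matrix_vector_mult_add_rdistrib mat_scale_mult_vec)
  ultimately have "x = y" "norm x = 1" "norm y = 1"
    using eq_if_norm_add_eq_2[of x y] norm_triangle_ineq[of x y] by auto
  then show ?thesis
    using that[of v] v(1) norm_y by (simp add: x_def y_def)
qed

text \<open>
  This is the orthogonality of eigenvectors of \<open>B\<^sup>*A\<close> for distinct unimodular eigenvalues
  \<open>\<theta>\<close> and \<open>\<eta>\<close>. With \<open>\<nu> = cnj \<theta> * \<eta>\<close>, preservation under \<open>A\<close> and under \<open>B\<close> of inner products with
  \<open>v\<close> gives \<open>\<langle>v, u\<rangle> = \<langle>v, \<nu>u\<rangle>\<close> for each multiple \<open>u\<close> of \<open>w\<close>, and \<open>\<nu> \<noteq> 1\<close>.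
\<close>

lemma orthogonal_norm_attaining_vectors:
  fixes A B :: "complex ^ 'k::finite ^ 'k"
  assumes A: "\<And>x. norm (A *v x) \<le> norm x" and B: "\<And>x. norm (B *v x) \<le> norm x"
    and v: "A *v v = \<theta> *s (B *v v)" "norm (A *v v) = norm v" "norm (B *v v) = norm v"
    and w: "A *v w = \<eta> *s (B *v w)"
    and "norm \<theta> = 1" "\<theta> \<noteq> \<eta>"
  shows "v \<bullet> w = 0"
proof -
  define \<nu> where "\<nu> = cnj \<theta> * \<eta>"
  have "\<theta> * cnj \<theta> = 1"
    using \<open>norm \<theta> = 1\<close> by (simp add: complex_norm_square[symmetric])
  then have "\<nu> \<noteq> 1"
    using \<open>\<theta> \<noteq> \<eta>\<close> unfolding \<nu>_def by (metis mult.assoc mult.left_neutral mult.right_neutral)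
  have A_inner: "(A *v v) \<bullet> (A *v u) = v \<bullet> u" for u
    using inner_preserved_where_norm_preserved[OF matrix_vector_mul_linear A v(2)] .
  have B_inner: "(B *v v) \<bullet> (B *v u) = v \<bullet> u" for u
    using inner_preserved_where_norm_preserved[OF matrix_vector_mul_linear B v(3)] .
  have twist: "v \<bullet> (c *s w) = v \<bullet> ((\<nu> * c) *s w)" for c
  proof -
    have "v \<bullet> (c *s w) = (\<theta> *s (B *v v)) \<bullet> (c *s (\<eta> *s (B *v w)))"
      using A_inner[of "c *s w"] by (simp add: vector_scalar_commute v(1) w)
    also have "\<dots> = (B *v v) \<bullet> (B *v ((\<nu> * c) *s w))"
      by (simp add: inner_complex_scale_left vector_scalar_commute \<nu>_def mult_ac)
    finally show ?thesis
      by (simp add: B_inner)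
  qed
  \<comment> \<open>This scalar turns the difference of the two sides of \<open>twist\<close> into \<open>v \<bullet> w\<close>.\<close>
  define c where "c = 1 / (1 - \<nu>)"
  have "c - \<nu> * c = 1"
    using \<open>\<nu> \<noteq> 1\<close> by (simp add: c_def field_simps)
  then have "w = c *s w - (\<nu> * c) *s w"
    by (metis vector_ssub_ldistrib vec.scale_left_diff_distrib vec.scale_one)
  then show ?thesis
    using twist[of c] by (metis inner_diff_right diff_self)
qed

lemma no_two_dimensional_l1_pair:
  fixes A B :: "complex ^ 'k::finite ^ 'k"
  assumes A: "\<And>x. norm (A *v x) \<le> norm x" and B: "\<And>x. norm (B *v x) \<le> norm x"
    and op: "\<And>\<theta>. norm \<theta> = 1 \<Longrightarrow> op_norm (A + mat_scale \<theta> B) = 2"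
  shows False
proof -
  let ?S = "sphere (0::complex) 1"
  have "\<exists>v. norm v = 1 \<and> A *v v = \<theta> *s (B *v v) \<and>
      norm (A *v v) = norm v \<and> norm (B *v v) = norm v" if "\<theta> \<in> ?S" for \<theta>
    using norm_attained_vector[OF A B, of \<theta>] op that by (metis mem_sphere_0)
  then obtain v where v: "\<And>\<theta>. \<theta> \<in> ?S \<Longrightarrow> norm (v \<theta>) = 1 \<and> A *v v \<theta> = \<theta> *s (B *v v \<theta>) \<and>
      norm (A *v v \<theta>) = norm (v \<theta>) \<and> norm (B *v v \<theta>) = norm (v \<theta>)"
    by metis
  have orth: "v \<theta> \<bullet> v \<eta> = 0" if "\<theta> \<in> ?S" "\<eta> \<in> ?S" "\<theta> \<noteq> \<eta>" for \<theta> \<eta>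
    using orthogonal_norm_attaining_vectors[OF A B, of "v \<theta>" \<theta> "v \<eta>" \<eta>]
      v[OF that(1)] v[OF that(2)] that by (metis mem_sphere_0)
  have "inj_on v ?S"
    by (rule inj_onI) (metis orth v inner_eq_zero_iff norm_zero zero_neq_one)
  moreover have "independent (v ` ?S)"
  proof (rule pairwise_orthogonal_independent)
    show "pairwise orthogonal (v ` ?S)"
      by (auto simp: pairwise_def orthogonal_def intro!: orth)
    show "0 \<notin> v ` ?S"
      using v by force
  qed
  then have "finite (v ` ?S)"
    using independent_bound by blast
  ultimately show False
    using infinite_unit_circle finite_imageD by blast
qed

section \<open>Reduction to two coordinates\<close>

lemma l1_norm_two_coordinates:
  fixes i j :: "'n::finite"
  assumes "i \<noteq> j"
  shows "l1_norm (a *s axis i 1 + b *s axis j 1) = norm a + norm b"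
proof -
  have "l1_norm (a *s axis i 1 + b *s axis j 1) =
      (\<Sum>k\<in>UNIV. (if k = i then norm a else 0) + (if k = j then norm b else 0))"
    unfolding l1_norm_def using assms by (intro sum.cong) (auto simp: axis_def)
  also have "\<dots> = norm a + norm b"
    by (simp add: sum.distrib)
  finally show ?thesis .
qed

theorem theorem1p19:
  assumes "CARD('n::finite) > 1"
  shows "\<not> (\<exists>\<phi> :: complex ^ 'n \<Rightarrow> complex ^ 'k::finite ^ 'k. l1_isometric_embedding \<phi>)"
proof
  assume "\<exists>\<phi> :: complex ^ 'n \<Rightarrow> complex ^ 'k ^ 'k. l1_isometric_embedding \<phi>"
  then obtain \<phi> :: "complex ^ 'n \<Rightarrow> complex ^ 'k ^ 'k"
    where lin: "Vector_Spaces.linear (*s) mat_scale \<phi>" and iso: "\<And>a. op_norm (\<phi> a) = l1_norm a"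
    unfolding l1_isometric_embedding_def by blast
  interpret Vector_Spaces.linear "(*s)" mat_scale \<phi> by (fact lin)
  obtain i j :: 'n where ij: "i \<noteq> j"
    using assms by (metis (full_types) UNIV_I card_1_singleton_iff card_le_Suc0_iff_eq finite not_less One_nat_def)
  define A B where "A = \<phi> (axis i 1)" and "B = \<phi> (axis j 1)"
  have comb: "op_norm (mat_scale a A + mat_scale b B) = norm a + norm b" for a b
    using iso[of "a *s axis i 1 + b *s axis j 1"] l1_norm_two_coordinates[OF ij]
    by (simp add: A_def B_def add scale)
  have scale_simps: "mat_scale 1 M = M" "mat_scale 0 M = 0" for M :: "complex ^ 'k ^ 'k"
    by (simp_all add: mat_scale_def vec_eq_iff)
  have contraction: "norm (M *v x) \<le> norm x" if "op_norm M = 1" for M :: "complex ^ 'k ^ 'k" and x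
    using onorm[OF matrix_vector_mul_bounded_linear, of M x] that by (simp add: op_norm_def)
  show False
  proof (rule no_two_dimensional_l1_pair)
    show "norm (A *v x) \<le> norm x" for x
      using comb[of 1 0] by (intro contraction) (simp add: scale_simps)
    show "norm (B *v x) \<le> norm x" for x
      using comb[of 0 1] by (intro contraction) (simp add: scale_simps)
    show "op_norm (A + mat_scale \<theta> B) = 2" if "norm \<theta> = 1" for \<theta>
      using comb[of 1 \<theta>] that by (simp add: scale_simps)
  qed
qed

end
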